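(* Let $\lambda\in\mathbb Q_{>1}$. The Identity Problem for a finite set $S$ in $G_\lambda$, i.e. the problem of deciding whether the identity element of $G_\lambda$ lies in the subsemigroup $S^+$ generated by $S$, is decidable in $O(|S|)$ operations.
   Context: For $\lambda\in\mathbb Q_{>1}$, $G_\lambda$ is the group under composition of maps $x\mapsto\lambda^nx+c$ with $n\in\mathbb Z$ and $c\in\mathbb Z[\lambda,\lambda^{-1}]$. $S^+$ is the set of all products of $\ell\ge1$ elements of $S$. The elements of $S$ are given by their pairs $(n,c)$. The operations counted are elementary operations on such maps and on rational numbers: testing the sign of $n$ and $c$, computing the unique fixed point $c/(1-\lambda^n)$ of a map with $n\neq0$, and comparing two rational numbers. *)

theory Defs
  imports "HOL-Algebra.Group" "HOL-Library.Landau_Symbols"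
begin

definition laurent_ring :: "rat \<Rightarrow> rat set" where
  "laurent_ring lam = {\<Sum>k\<in>K. of_int (a k) * lam powi k | (K :: int set) (a :: int \<Rightarrow> int). finite K}"

text \<open>The maps are taken as self-maps of the rationals, which determine \<open>n\<close> and \<open>c\<close> when \<open>lam > 1\<close>.\<close>

definition affine :: "rat \<Rightarrow> int \<times> rat \<Rightarrow> rat \<Rightarrow> rat" where
  "affine lam = (\<lambda>(n, c) x. lam powi n * x + c)"

definition affine_group :: "rat \<Rightarrow> (rat \<Rightarrow> rat) monoid" where
  "affine_group lam =
     \<lparr>carrier = affine lam ` (UNIV \<times> laurent_ring lam), mult = (\<circ>), one = id\<rparr>"

definition semigroup_span :: "('a, 'b) monoid_scheme \<Rightarrow> 'a set \<Rightarrow> 'a set" where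
  "semigroup_span G S = {foldr (mult G) fs (one G) | fs. fs \<noteq> [] \<and> set fs \<subseteq> S}"

lemma laurent_ring_add:
  assumes "c \<in> laurent_ring lam" "d \<in> laurent_ring lam"
  shows "c + d \<in> laurent_ring lam"
proof -
  obtain K a where K: "finite K" and c: "c = (\<Sum>k\<in>K. of_int (a k) * lam powi k)"
    using assms(1) unfolding laurent_ring_def by blast
  obtain L b where L: "finite L" and d: "d = (\<Sum>k\<in>L. of_int (b k) * lam powi k)"
    using assms(2) unfolding laurent_ring_def by blast
  let ?a = "\<lambda>k. if k \<in> K then a k else 0" and ?b = "\<lambda>k. if k \<in> L then b k else 0"
  have "c = (\<Sum>k\<in>K \<union> L. of_int (?a k) * lam powi k)"
    unfolding c using K L by (intro sum.mono_neutral_cong_left) auto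
  moreover have "d = (\<Sum>k\<in>K \<union> L. of_int (?b k) * lam powi k)"
    unfolding d using K L by (intro sum.mono_neutral_cong_left) auto
  ultimately have "c + d = (\<Sum>k\<in>K \<union> L. of_int (?a k + ?b k) * lam powi k)"
    by (simp add: sum.distrib[symmetric] distrib_right)
  moreover have "finite (K \<union> L)" using K L by simp
  ultimately show ?thesis
    unfolding laurent_ring_def by (intro CollectI exI[of _ "K \<union> L"] exI[of _ "\<lambda>k. ?a k + ?b k"]) simp
qed

lemma laurent_ring_zero: "0 \<in> laurent_ring lam"
  unfolding laurent_ring_def by (intro CollectI exI[of _ "{}"]) simp

lemma laurent_ring_uminus: "c \<in> laurent_ring lam \<Longrightarrow> - c \<in> laurent_ring lam"
proof -
  assume "c \<in> laurent_ring lam"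
  then obtain K a where K: "finite K" and c: "c = (\<Sum>k\<in>K. of_int (a k) * lam powi k)"
    unfolding laurent_ring_def by blast
  have "- c = (\<Sum>k\<in>K. of_int (- a k) * lam powi k)"
    unfolding c by (simp add: sum_negf)
  then show ?thesis
    unfolding laurent_ring_def using K by (intro CollectI exI[of _ K] exI[of _ "\<lambda>k. - a k"]) simp
qed

lemma laurent_ring_shift:
  assumes "lam \<noteq> 0" "c \<in> laurent_ring lam"
  shows "lam powi n * c \<in> laurent_ring lam"
proof -
  obtain K a where K: "finite K" and c: "c = (\<Sum>k\<in>K. of_int (a k) * lam powi k)"
    using assms(2) unfolding laurent_ring_def by blast
  have "lam powi n * c = (\<Sum>k\<in>(+) n ` K. of_int (a (k - n)) * lam powi k)"
    unfolding c sum_distrib_left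
    by (subst sum.reindex) (auto simp: power_int_add assms(1) intro!: sum.cong)
  moreover have "finite ((+) n ` K)" using K by simp
  ultimately show ?thesis
    unfolding laurent_ring_def
    by (intro CollectI exI[of _ "(+) n ` K"] exI[of _ "\<lambda>k. a (k - n)"]) simp
qed

lemma group_affine_group:
  assumes "lam > 1"
  shows "group (affine_group lam)"
proof (rule groupI)
  fix f g assume "f \<in> carrier (affine_group lam)" "g \<in> carrier (affine_group lam)"
  then obtain n c m d where f: "f = affine lam (n, c)" "c \<in> laurent_ring lam"
    and g: "g = affine lam (m, d)" "d \<in> laurent_ring lam"
    unfolding affine_group_def by auto
  have "f \<circ> g = affine lam (n + m, lam powi n * d + c)"
    unfolding f g affine_def using assms by (auto simp: power_int_add algebra_simps)
  moreover have "lam powi n * d + c \<in> laurent_ring lam"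
    using assms f g by (intro laurent_ring_add laurent_ring_shift) auto
  ultimately show "f \<otimes>\<^bsub>affine_group lam\<^esub> g \<in> carrier (affine_group lam)"
    unfolding affine_group_def by auto
next
  have "id = affine lam (0, 0)" unfolding affine_def by auto
  then show "\<one>\<^bsub>affine_group lam\<^esub> \<in> carrier (affine_group lam)"
    unfolding affine_group_def using laurent_ring_zero by auto
next
  fix f assume "f \<in> carrier (affine_group lam)"
  then obtain n c where f: "f = affine lam (n, c)" "c \<in> laurent_ring lam"
    unfolding affine_group_def by auto
  let ?g = "affine lam (- n, - (lam powi (- n) * c))"
  have "?g \<circ> f = id"
    unfolding f affine_def using assms by (auto simp: power_int_minus field_simps)
  moreover have "- (lam powi (- n) * c) \<in> laurent_ring lam"
    using assms f by (intro laurent_ring_uminus laurent_ring_shift) auto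
  ultimately show "\<exists>g\<in>carrier (affine_group lam). g \<otimes>\<^bsub>affine_group lam\<^esub> f = \<one>\<^bsub>affine_group lam\<^esub>"
    unfolding affine_group_def by auto
qed (auto simp: affine_group_def comp_assoc)

text \<open>
  The computation model. A program is a finite list of instructions; control locations are
  positions in that list, so an algorithm is one finite object that serves inputs of every size.
  The input is a list of pairs \<open>(n, c)\<close>, of which the program sees the entry under a read head.
  Rationals are stored in registers, initially \<open>0\<close>. Input entries and registers are accessible only
  through the instructions below, and every executed instruction counts as one operation, including
  those that move the head or halt.

  The three targets of a test are for a negative, zero and positive sign, and
  \<open>Compare i j\<close> tests the sign of \<open>R\<^sub>i - R\<^sub>j\<close>.
\<close>

datatype instr =
    Sign_n nat nat nat
  | Sign_c nat nat nat
  | Fixed_point nat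
  | Compare nat nat nat nat nat
  | At_end nat nat
  | Advance
  | Rewind
  | Answer bool

type_synonym config = "nat \<times> nat \<times> (nat \<Rightarrow> rat)"  \<comment> \<open>location, head position, registers\<close>

datatype outcome = Continue config | Halted bool | Stuck

definition branch :: "'a::linordered_idom \<Rightarrow> nat \<Rightarrow> nat \<Rightarrow> nat \<Rightarrow> nat" where
  "branch x l1 l2 l3 = (if x < 0 then l1 else if x = 0 then l2 else l3)"

fun exec :: "rat \<Rightarrow> (int \<times> rat) list \<Rightarrow> instr \<Rightarrow> config \<Rightarrow> outcome" where
  "exec lam xs (Sign_n l1 l2 l3) (pc, h, R) =
     (if h < length xs then Continue (branch (fst (xs ! h)) l1 l2 l3, h, R) else Stuck)"
| "exec lam xs (Sign_c l1 l2 l3) (pc, h, R) =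
     (if h < length xs then Continue (branch (snd (xs ! h)) l1 l2 l3, h, R) else Stuck)"
| "exec lam xs (Fixed_point i) (pc, h, R) =
     (if h < length xs \<and> fst (xs ! h) \<noteq> 0
      then Continue (Suc pc, h, R(i := snd (xs ! h) / (1 - lam powi fst (xs ! h)))) else Stuck)"
| "exec lam xs (Compare i j l1 l2 l3) (pc, h, R) = Continue (branch (R i - R j) l1 l2 l3, h, R)"
| "exec lam xs (At_end l1 l2) (pc, h, R) =
     Continue (if h < length xs then l2 else l1, h, R)"
| "exec lam xs Advance (pc, h, R) = Continue (Suc pc, Suc h, R)"
| "exec lam xs Rewind (pc, h, R) = Continue (Suc pc, 0, R)"
| "exec lam xs (Answer b) (pc, h, R) = Halted b"

definition step :: "rat \<Rightarrow> instr list \<Rightarrow> (int \<times> rat) list \<Rightarrow> config \<Rightarrow> outcome" where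
  "step lam p xs cfg = (if fst cfg < length p then exec lam xs (p ! fst cfg) cfg else Stuck)"

text \<open>\<open>run lam p xs t cfg = Some b\<close> means that, started in \<open>cfg\<close>, the program halts with answer
  \<open>b\<close> after at most \<open>t\<close> operations.\<close>

fun run :: "rat \<Rightarrow> instr list \<Rightarrow> (int \<times> rat) list \<Rightarrow> nat \<Rightarrow> config \<Rightarrow> bool option" where
  "run lam p xs 0 cfg = None"
| "run lam p xs (Suc t) cfg =
     (case step lam p xs cfg of
        Continue cfg' \<Rightarrow> run lam p xs t cfg'
      | Halted b \<Rightarrow> Some b
      | Stuck \<Rightarrow> None)"

definition answers_within :: "rat \<Rightarrow> instr list \<Rightarrow> (int \<times> rat) list \<Rightarrow> nat \<Rightarrow> bool \<Rightarrow> bool" where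
  "answers_within lam p xs t b \<longleftrightarrow> run lam p xs t (0, 0, \<lambda>_. 0) = Some b"

end

theory Submission
  imports Defs
begin

text \<open>
  If \<open>g\<close> is expanding with fixed point \<open>a\<close> and \<open>h\<close> is contracting with fixed point \<open>b\<close>, then some
  product \<open>g\<^sup>m h\<^sup>n\<close> is the translation by a positive multiple of \<open>b - a\<close>. Call the numbers
  \<open>b - a\<close>, together with the translations in \<open>S\<close>, the drifts of \<open>S\<close>. If \<open>0\<close> is a drift, or if
  there are drifts of both signs, then \<open>S\<^sup>+\<close> contains the identity, since rational translations are
  commensurable. If all drifts are, say, negative, then every \<open>b\<close> lies to the left of every \<open>a\<close>, and
  a point between them is moved strictly to the left by every element of \<open>S\<close>, hence by every
  product. The signs of the drifts are determined by those of the translations and by comparing the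
  extremal values of \<open>a\<close> and \<open>b\<close>, which takes a bounded number of passes over the input.
\<close>

section \<open>The identity criterion\<close>

definition fixp :: "rat \<Rightarrow> int \<times> rat \<Rightarrow> rat" where
  "fixp lam g = snd g / (1 - lam powi fst g)"

text \<open>For \<open>lam > 1\<close>, \<open>s = 1\<close> selects the expanding maps and
  \<open>s = -1\<close> the contracting ones.\<close>

definition fixps :: "rat \<Rightarrow> int \<Rightarrow> (int \<times> rat) set \<Rightarrow> rat set" where
  "fixps lam s X = fixp lam ` {g \<in> X. sgn (fst g) = s}"

definition drifts :: "rat \<Rightarrow> (int \<times> rat) set \<Rightarrow> rat set" where
  "drifts lam X = {c. (0, c) \<in> X} \<union> {b - a | a b. a \<in> fixps lam 1 X \<and> b \<in> fixps lam (-1) X}"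

section \<open>Products in the span and powers of affine maps\<close>

lemma span_member: "f \<in> S \<Longrightarrow> f \<in> semigroup_span (affine_group lam) S"
  unfolding semigroup_span_def affine_group_def by (intro CollectI exI[of _ "[f]"]) auto

lemma span_comp:
  assumes "f \<in> semigroup_span (affine_group lam) S" "g \<in> semigroup_span (affine_group lam) S"
  shows "f \<circ> g \<in> semigroup_span (affine_group lam) S"
proof -
  obtain fs gs where "f = foldr (\<circ>) fs id" "fs \<noteq> []" "set fs \<subseteq> S"
    and "g = foldr (\<circ>) gs id" "gs \<noteq> []" "set gs \<subseteq> S"
    using assms unfolding semigroup_span_def affine_group_def by auto
  moreover have "foldr (\<circ>) (fs @ gs) id = foldr (\<circ>) fs id \<circ> foldr (\<circ>) gs id"
    by (induction fs) (auto simp: comp_assoc)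
  ultimately show ?thesis
    unfolding semigroup_span_def affine_group_def
    by (intro CollectI exI[of _ "fs @ gs"]) (simp del: foldr_append)
qed

lemma span_funpow:
  assumes "f \<in> semigroup_span (affine_group lam) S" "k > 0"
  shows "f ^^ k \<in> semigroup_span (affine_group lam) S"
  using assms(2)
proof (induction k rule: nat_induct_non_zero)
  case 1
  then show ?case using assms(1) by simp
next
  case (Suc k)
  then show ?case using span_comp[OF assms(1)] by (simp only: funpow.simps)
qed

text \<open>As \<open>lam > 1\<close> and the exponent is nonzero, \<open>lam powi fst g\<close>
  differs from 1, so the division in \<open>fixp\<close> is genuine. Centred at its fixed point the
  map is a pure scaling, which makes its powers explicit.\<close>

lemma affine_conv_fixp:
  assumes "lam > 1" "fst g \<noteq> 0"
  shows "affine lam g x = fixp lam g + lam powi fst g * (x - fixp lam g)"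
proof -
  have "lam powi fst g \<noteq> 1"
    using assms power_int_strict_increasing[of "fst g" 0 lam]
      power_int_strict_increasing[of 0 "fst g" lam] by force
  then have "fixp lam g * (1 - lam powi fst g) = snd g" unfolding fixp_def by simp
  then show ?thesis
    unfolding affine_def by (simp add: case_prod_beta algebra_simps)
qed

lemma affine_funpow:
  assumes "lam > 1" "fst g \<noteq> 0"
  shows "(affine lam g ^^ k) x = fixp lam g + lam powi (fst g * int k) * (x - fixp lam g)"
proof (induction k)
  case (Suc k)
  have "(affine lam g ^^ Suc k) x = affine lam g ((affine lam g ^^ k) x)" by simp
  also have "\<dots> = fixp lam g + lam powi fst g * (lam powi (fst g * int k) * (x - fixp lam g))"
    by (simp add: affine_conv_fixp[OF assms] Suc.IH)
  finally show ?case
    using assms by (simp add: power_int_add algebra_simps)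
qed simp

section \<open>Translations obtained from drifts\<close>

lemma translation_funpow: "((\<lambda>x. x + u) ^^ k) = (\<lambda>x::rat. x + of_nat k * u)"
  by (induction k) (auto simp: algebra_simps)

lemma drift_translation:
  assumes "lam > 1" "x \<in> drifts lam X"
  shows "\<exists>k>0. (\<lambda>y. y + k * x) \<in> semigroup_span (affine_group lam) (affine lam ` X)"
proof (cases "(0, x) \<in> X")
  case True
  moreover have "affine lam (0, x) = (\<lambda>y. y + 1 * x)" unfolding affine_def by simp
  ultimately show ?thesis
    by (metis image_eqI span_member zero_less_one)
next
  case False
  then obtain g h where gh: "g \<in> X" "h \<in> X" "fst g > 0" "fst h < 0"
    and x: "x = fixp lam h - fixp lam g"
    using assms(2) unfolding drifts_def fixps_def by (auto simp: sgn_1_pos sgn_1_neg)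
  \<comment> \<open>The exponents are crossed so that \<open>fst g * m + fst h * n = 0\<close>: the
    linear parts cancel and the product is a translation.\<close>
  define m n where "m = nat (- fst h)" and "n = nat (fst g)"
  let ?k = "lam powi (fst g * int m)"
  have pos: "m > 0" "n > 0" using gh by (auto simp: m_def n_def)
  have "?k > lam powi 0"
    using assms(1) gh pos by (intro power_int_strict_increasing) auto
  then have k: "?k > 1" by simp
  have "fst h * int n = - (fst g * int m)" using gh by (simp add: m_def n_def)
  \<comment> \<open>With fixed points a of \<open>g\<close> and b of \<open>h\<close>, the value at
    y is a + k * (b + (y - b) / k - a) = y + (k - 1) * (b - a).\<close>
  then have "(affine lam g ^^ m \<circ> affine lam h ^^ n) y = y + (?k - 1) * x" for y
    using gh assms(1) k
    by (simp add: affine_funpow x power_int_minus field_simps)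
  moreover have "affine lam g ^^ m \<circ> affine lam h ^^ n
      \<in> semigroup_span (affine_group lam) (affine lam ` X)"
    using gh pos by (intro span_comp span_funpow span_member) auto
  ultimately have "(\<lambda>y. y + (?k - 1) * x) \<in> semigroup_span (affine_group lam) (affine lam ` X)"
    by (metis (no_types, lifting) ext)
  then show ?thesis using k by (intro exI[of _ "?k - 1"]) simp
qed

text \<open>The ratio \<open>u / - v\<close> is a positive fraction; its denominator and numerator
  serve as the multiplicities of \<open>u\<close> and \<open>v\<close>.\<close>

lemma rat_commensurable:
  fixes u v :: rat
  assumes "u > 0" "v < 0"
  obtains i j :: nat where "i > 0" "j > 0" "of_nat i * u + of_nat j * v = 0"
proof -
  obtain a b where ab: "u / - v = Fract a b" "b > 0"
    by (cases "u / - v") auto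
  have "0 < u / - v" using assms by (simp add: divide_pos_neg)
  then have a: "a > 0" unfolding ab(1) using ab(2) by (simp add: zero_less_Fract_iff)
  have "u / - v = of_int a / of_int b" using ab by (simp add: Fract_of_int_quotient)
  then have "of_int b * u + of_int a * v = 0" using assms ab by (simp add: field_simps)
  then show ?thesis using that[of "nat b" "nat a"] a ab by simp
qed

section \<open>Drifts of one sign exclude the identity\<close>

lemma finite_separation:
  fixes A B :: "'a::{linorder, dense_order, no_top, no_bot} set"
  assumes "finite A" "finite B" "\<And>a b. a \<in> A \<Longrightarrow> b \<in> B \<Longrightarrow> b < a"
  shows "\<exists>p. (\<forall>a\<in>A. p < a) \<and> (\<forall>b\<in>B. b < p)"
proof (cases "A = {} \<or> B = {}")
  case True
  \<comment> \<open>\<open>Max\<close> and \<open>Min\<close> of an empty set are unspecified, so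
    each bound is used only when its set is nonempty.\<close>
  obtain p q where "Max B < p" "q < Min A" using gt_ex lt_ex by metis
  then have "B \<noteq> {} \<Longrightarrow> \<forall>b\<in>B. b < p" "A \<noteq> {} \<Longrightarrow> \<forall>a\<in>A. q < a"
    using assms(1,2) by auto
  then show ?thesis using True by blast
next
  case False
  then have "Max B < Min A" using assms by simp
  then show ?thesis
    using dense[of "Max B" "Min A"] assms False by auto
qed

text \<open>The tail of the product moves \<open>p\<close> in the right direction, the head
  preserves this by monotonicity, and then the head moves \<open>p\<close> itself. The factor
  \<open>d\<close> handles both orientations.\<close>

lemma foldr_comp_less:
  fixes p d :: rat
  assumes "fs \<noteq> []"
    and less: "\<And>f. f \<in> set fs \<Longrightarrow> d * f p < d * p"
    and mono: "\<And>f x y. f \<in> set fs \<Longrightarrow> d * x < d * y \<Longrightarrow> d * f x < d * f y"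
  shows "d * foldr (\<circ>) fs id p < d * p"
  using assms
proof (induction fs)
  case (Cons f fs)
  show ?case
  proof (cases "fs = []")
    case True
    then show ?thesis using Cons.prems(2) by simp
  next
    case False
    then have "d * foldr (\<circ>) fs id p < d * p" using Cons by (metis list.set_intros(2))
    then have "d * f (foldr (\<circ>) fs id p) < d * f p" by (rule Cons.prems(3)[OF list.set_intros(1)])
    also have "\<dots> < d * p" using Cons.prems(2) by simp
    finally show ?thesis by (metis comp_apply foldr.simps(2))
  qed
qed simp

text \<open>The factor \<open>d\<close> reflects the line if necessary, so that only negative drifts
  have to be argued. Finiteness of \<open>X\<close> leaves room for a point strictly between the two
  kinds of fixed points.\<close>

lemma drifts_one_sign:
  assumes lam: "lam > 1" and "finite X" and d: "d = 1 \<or> d = - 1"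
    and neg: "\<And>x. x \<in> drifts lam X \<Longrightarrow> d * x < 0"
  shows "id \<notin> semigroup_span (affine_group lam) (affine lam ` X)"
proof -
  have fin: "finite (fixps lam s X)" for s unfolding fixps_def using \<open>finite X\<close> by simp
  have "d * (b - a) < 0" if "a \<in> fixps lam 1 X" "b \<in> fixps lam (-1) X" for a b
    using that by (intro neg) (auto simp: drifts_def)
  then have "\<exists>q. (\<forall>a\<in>(*) d ` fixps lam 1 X. q < a) \<and> (\<forall>b\<in>(*) d ` fixps lam (-1) X. b < q)"
    using fin by (intro finite_separation) (auto simp: algebra_simps)
  then obtain q where q: "\<And>a. a \<in> fixps lam 1 X \<Longrightarrow> q < d * a"
    "\<And>b. b \<in> fixps lam (-1) X \<Longrightarrow> d * b < q" by auto
  \<comment> \<open>Since \<open>d * d = 1\<close>, this gives \<open>d * p = q\<close>, the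
    separating point on the reflected line.\<close>
  define p where "p = d * q"
  have less: "d * affine lam g p < d * p" if g: "g \<in> X" for g
  proof (cases "fst g = 0")
    case True
    then have "snd g \<in> drifts lam X" using g
      unfolding drifts_def by (metis (mono_tags) UnI1 mem_Collect_eq prod.collapse)
    then show ?thesis using neg[of "snd g"] True by (simp add: affine_def case_prod_beta algebra_simps)
  next
    case False
    define a l where "a = fixp lam g" and "l = lam powi fst g"
    \<comment> \<open>This product is the reflected displacement of \<open>p\<close>. An expanding
      map has its fixed point above and pushes away from it; a contracting map has it below and
      pulls towards it. Both move downwards.\<close>
    have "(l - 1) * (q - d * a) < 0"
    proof (cases "fst g > 0")
      case True
      have "q < d * a" using True g q unfolding fixps_def a_def by (auto simp: sgn_1_pos)
      moreover have "l > 1" using power_int_strict_increasing[of 0 "fst g" lam] True lam by (simp add: l_def)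
      ultimately show ?thesis by (simp add: mult_pos_neg)
    next
      case neg: False
      have "q > d * a" using neg False g q unfolding fixps_def a_def by (auto simp: sgn_1_neg)
      moreover have "l < 1"
        using power_int_strict_increasing[of "fst g" 0 lam] neg False lam by (simp add: l_def)
      ultimately show ?thesis by (simp add: mult_neg_pos)
    qed
    moreover have "d * affine lam g p - d * p = (l - 1) * (q - d * a)"
      using affine_conv_fixp[OF lam False, of p] d
      by (auto simp: p_def a_def l_def algebra_simps)
    ultimately show ?thesis by simp
  qed
  have mono: "d * affine lam g x < d * affine lam g y" if "d * x < d * y" for g x y
  proof -
    have "lam powi fst g > 0" using lam by simp
    then have "lam powi fst g * (d * x) < lam powi fst g * (d * y)" using that by simp
    then show ?thesis by (simp add: affine_def case_prod_beta algebra_simps)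
  qed
  show ?thesis
  proof
    assume "id \<in> semigroup_span (affine_group lam) (affine lam ` X)"
    then obtain fs where fs: "id = foldr (\<circ>) fs id" "fs \<noteq> []" "set fs \<subseteq> affine lam ` X"
      unfolding semigroup_span_def affine_group_def by auto
    have "d * foldr (\<circ>) fs id p < d * p"
      using fs less mono by (intro foldr_comp_less) blast+
    then show False using fs(1) by (metis id_apply less_irrefl)
  qed
qed

theorem id_in_span_iff:
  assumes lam: "lam > 1" and "finite X"
  shows "id \<in> semigroup_span (affine_group lam) (affine lam ` X) \<longleftrightarrow>
    0 \<in> drifts lam X \<or> (\<exists>x\<in>drifts lam X. x > 0) \<and> (\<exists>x\<in>drifts lam X. x < 0)"
    (is "?L \<longleftrightarrow> ?R")
proof
  assume ?L
  show ?R
  proof (rule ccontr)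
    assume "\<not> ?R"
    \<comment> \<open>Without \<open>0\<close> and without both signs, all drifts share one sign;
      both alternatives hold if there is no drift at all.\<close>
    then have "(\<forall>x\<in>drifts lam X. 1 * x < 0) \<or> (\<forall>x\<in>drifts lam X. - 1 * x < 0)"
      by (metis linorder_neqE_linordered_idom mult_1 mult_minus1 neg_less_0_iff_less)
    then show False using drifts_one_sign[OF assms] \<open>?L\<close> by blast
  qed
next
  assume ?R
  then show ?L
  proof
    assume "0 \<in> drifts lam X"
    then show ?L using drift_translation[OF lam, of 0 X] by (auto simp: id_def)
  next
    assume "(\<exists>x\<in>drifts lam X. x > 0) \<and> (\<exists>x\<in>drifts lam X. x < 0)"
    then obtain x y where "x \<in> drifts lam X" "x > 0" "y \<in> drifts lam X" "y < 0" by auto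
    then obtain k l where "k > 0" "l > 0"
      and kl: "(\<lambda>z. z + k * x) \<in> semigroup_span (affine_group lam) (affine lam ` X)"
        "(\<lambda>z. z + l * y) \<in> semigroup_span (affine_group lam) (affine lam ` X)"
      using drift_translation[OF lam] by metis
    then have "k * x > 0" "l * y < 0" using \<open>x > 0\<close> \<open>y < 0\<close> by (simp_all add: mult_pos_neg)
    \<comment> \<open>Only the multiples \<open>k * x\<close> and \<open>l * y\<close> are available
      as translations, so these are made to cancel.\<close>
    then obtain i j :: nat where ij: "i > 0" "j > 0" "of_nat i * (k * x) + of_nat j * (l * y) = 0"
      using rat_commensurable by metis
    have "(\<lambda>z. z + k * x) ^^ i \<circ> (\<lambda>z. z + l * y) ^^ j
        \<in> semigroup_span (affine_group lam) (affine lam ` X)"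
      using kl ij by (intro span_comp span_funpow)
    moreover have "(\<lambda>z. z + k * x) ^^ i \<circ> (\<lambda>z. z + l * y) ^^ j = id"
      using ij(3) by (auto simp: translation_funpow fun_eq_iff algebra_simps)
    ultimately show ?L by simp
  qed
qed

section \<open>Execution of programs\<close>

text \<open>Since \<open>run\<close> is monotone in its step bound, \<open>k\<close> is an upper bound on the number of
  operations between the two configurations, not the exact number.\<close>

definition takes :: "rat \<Rightarrow> instr list \<Rightarrow> (int \<times> rat) list \<Rightarrow> config \<Rightarrow> nat \<Rightarrow> config \<Rightarrow> bool" where
  "takes lam p xs cfg k cfg' \<longleftrightarrow>
     (\<forall>t b. run lam p xs t cfg' = Some b \<longrightarrow> run lam p xs (t + k) cfg = Some b)"

lemma run_mono: "run lam p xs t cfg = Some b \<Longrightarrow> t \<le> t' \<Longrightarrow> run lam p xs t' cfg = Some b"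
proof (induction t arbitrary: t' cfg)
  case (Suc t)
  then obtain u where "t' = Suc u" "t \<le> u" by (cases t') auto
  with Suc show ?case by (auto split: outcome.splits)
qed simp

lemma takes_refl: "takes lam p xs cfg 0 cfg"
  unfolding takes_def by simp

text \<open>The slack in \<open>n\<close> lets branches of different lengths share one
  bound.\<close>

lemma takes_trans:
  assumes "takes lam p xs c j c'" "takes lam p xs c' k c''" "j + k \<le> n"
  shows "takes lam p xs c n c''"
  unfolding takes_def
proof (intro allI impI)
  fix t b assume "run lam p xs t c'' = Some b"
  then have "run lam p xs (t + k + j) c = Some b" using assms unfolding takes_def by blast
  then show "run lam p xs (t + n) c = Some b" using assms(3) by (elim run_mono) simp
qed

lemma takes_weaken: "takes lam p xs c j c' \<Longrightarrow> j \<le> k \<Longrightarrow> takes lam p xs c k c'"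
  using takes_trans[OF _ takes_refl] by simp

text \<open>Jump targets are absolute, so a block works only at the location for which it was
  generated. Recording that location allows each block to be verified separately.\<close>

definition code_at :: "instr list \<Rightarrow> nat \<Rightarrow> instr list \<Rightarrow> bool" where
  "code_at p b blk \<longleftrightarrow> (\<exists>us vs. p = us @ blk @ vs \<and> length us = b)"

lemma code_at_append:
  assumes "code_at p b (blk @ blk')"
  shows "code_at p b blk" "code_at p (b + length blk) blk'"
proof -
  obtain us vs where p: "p = us @ (blk @ blk') @ vs" "length us = b"
    using assms unfolding code_at_def by blast
  show "code_at p b blk" unfolding code_at_def
    using p by (intro exI[of _ us] exI[of _ "blk' @ vs"]) simp
  show "code_at p (b + length blk) blk'" unfolding code_at_def
    using p by (intro exI[of _ "us @ blk"] exI[of _ vs]) simp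
qed

lemma step_code_at:
  assumes "code_at p b blk" "i < length blk"
  shows "step lam p xs (b + i, h, R) = exec lam xs (blk ! i) (b + i, h, R)"
  using assms unfolding code_at_def step_def by (auto simp: nth_append)

text \<open>The model has no unconditional jump; a test with three equal targets replaces
  it.\<close>

definition jump :: "nat \<Rightarrow> instr" where
  "jump l = Compare 0 0 l l l"

lemma exec_jump [simp]: "exec lam xs (jump l) (pc, h, R) = Continue (l, h, R)"
  by (simp add: jump_def branch_def)

text \<open>A zero exponent always leads to \<open>k\<close>. This guards
  \<open>Fixed_point\<close>, which is stuck on translations.\<close>

definition on_sign :: "int \<Rightarrow> nat \<Rightarrow> nat \<Rightarrow> instr" where
  "on_sign s l k = Sign_n (if s < 0 then l else k) k (if s < 0 then k else l)"

lemma exec_on_sign: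
  assumes "s = 1 \<or> s = -1" "h < length xs"
  shows "exec lam xs (on_sign s l k) (pc, h, R) =
    Continue (if sgn (fst (xs ! h)) = s then l else k, h, R)"
  using assms by (auto simp: on_sign_def branch_def sgn_if)

text \<open>Exchanging the registers negates their difference, so \<open>d = -1\<close> turns a
  search for minima into one for maxima.\<close>

definition compare :: "rat \<Rightarrow> nat \<Rightarrow> nat \<Rightarrow> nat \<Rightarrow> nat \<Rightarrow> nat \<Rightarrow> instr" where
  "compare d i j l1 l2 l3 = (if d > 0 then Compare i j l1 l2 l3 else Compare j i l1 l2 l3)"

lemma exec_compare:
  assumes "d = 1 \<or> d = -1"
  shows "exec lam xs (compare d i j l1 l2 l3) (pc, h, R) =
    Continue (branch (d * (R i - R j)) l1 l2 l3, h, R)"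
  using assms by (auto simp: compare_def)

section \<open>A linear-time program\<close>

definition find_translation :: "nat \<Rightarrow> rat \<Rightarrow> nat \<Rightarrow> nat \<Rightarrow> instr list" where
  "find_translation b e found missing =
     [Rewind,
      At_end missing (b + 2),
      Sign_n (b + 4) (b + 3) (b + 4),
      Sign_c (if e < 0 then found else b + 4) (if e = 0 then found else b + 4)
        (if e > 0 then found else b + 4),
      Advance,
      jump (b + 1)]"

lemma length_find_translation [simp]: "length (find_translation b e found missing) = 6"
  by (simp add: find_translation_def)

text \<open>Induction on the unread suffix \<open>ys\<close>. An entry costs at most five
  operations: end test, two sign tests, advance and jump. The additional one is the final end
  test.\<close>

lemma find_translation_loop:
  assumes code: "code_at p b (find_translation b e found missing)"
    and "xs = zs @ ys" "h = length zs" and e: "e \<in> {-1, 0, 1}"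
  shows "\<exists>h'. takes lam p xs (b + 1, h, R) (5 * length ys + 1)
    (if \<exists>c. (0, c) \<in> set ys \<and> sgn c = e then found else missing, h', R)"
  using assms(2,3)
proof (induction ys arbitrary: zs h)
  case Nil
  note instr = step_code_at[OF code, unfolded find_translation_def, simplified]
  have "step lam p xs (b + 1, h, R) = Continue (missing, h, R)"
    using Nil instr[of 1] by simp
  then have "takes lam p xs (b + 1, h, R) 1 (missing, h, R)" by (simp add: takes_def)
  then show ?case by auto
next
  case (Cons g ys)
  note instr = step_code_at[OF code, unfolded find_translation_def, simplified]
  have h: "h < length xs" "xs ! h = g" using Cons.prems by simp_all
  have s1: "step lam p xs (b + 1, h, R) = Continue (b + 2, h, R)"
    using h instr[of 1] by simp
  have s2: "step lam p xs (b + 2, h, R) = Continue (if fst g = 0 then b + 3 else b + 4, h, R)"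
    using h instr[of 2] by (simp add: branch_def)
  have s3: "step lam p xs (b + 3, h, R) = Continue (if sgn (snd g) = e then found else b + 4, h, R)"
    using h e instr[of 3] by (auto simp: branch_def sgn_if)
  have s4: "step lam p xs (b + 4, h, R) = Continue (b + 5, Suc h, R)"
    using instr[of 4] by simp
  have s5: "step lam p xs (b + 5, Suc h, R) = Continue (b + 1, Suc h, R)"
    using instr[of 5] by simp
  show ?case
  proof (cases "fst g = 0 \<and> sgn (snd g) = e")
    case True
    then have ex: "\<exists>c. (0, c) \<in> set (g # ys) \<and> sgn c = e" by (cases g) auto
    have "takes lam p xs (b + 1, h, R) 3 (found, h, R)"
      using True s1 s2 s3 by (simp add: takes_def numeral_eq_Suc)
    then have "takes lam p xs (b + 1, h, R) (5 * length (g # ys) + 1) (found, h, R)"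
      by (rule takes_weaken) simp
    then show ?thesis unfolding if_P[OF ex] by blast
  next
    case False
    then have eq: "(\<exists>c. (0, c) \<in> set (g # ys) \<and> sgn c = e) \<longleftrightarrow> (\<exists>c. (0, c) \<in> set ys \<and> sgn c = e)"
      by (cases g) auto
    have "takes lam p xs (b + 4, h, R) 2 (b + 1, Suc h, R)"
      using s4 s5 by (simp add: takes_def numeral_eq_Suc)
    moreover have "takes lam p xs (b + 1, h, R) 3 (b + 4, h, R)"
    proof (cases "fst g = 0")
      case True
      then show ?thesis using False s1 s2 s3 by (simp add: takes_def numeral_eq_Suc)
    next
      case False
      then have "takes lam p xs (b + 1, h, R) 2 (b + 4, h, R)"
        using s1 s2 by (simp add: takes_def numeral_eq_Suc)
      then show ?thesis by (rule takes_weaken) simp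
    qed
    ultimately have to1: "takes lam p xs (b + 1, h, R) 5 (b + 1, Suc h, R)"
      using takes_trans by fastforce
    obtain h' where "takes lam p xs (b + 1, Suc h, R) (5 * length ys + 1)
      (if \<exists>c. (0, c) \<in> set ys \<and> sgn c = e then found else missing, h', R)"
      using Cons.IH[of "zs @ [g]" "Suc h"] Cons.prems by auto
    from takes_trans[OF to1 this] show ?thesis unfolding eq by fastforce
  qed
qed

lemma find_translation:
  assumes code: "code_at p b (find_translation b e found missing)" and e: "e \<in> {-1, 0, 1}"
  shows "\<exists>h'. takes lam p xs (b, h, R) (5 * length xs + 2)
    (if \<exists>c. (0, c) \<in> set xs \<and> sgn c = e then found else missing, h', R)"
proof -
  have "step lam p xs (b, h, R) = Continue (b + 1, 0, R)"
    using step_code_at[OF code, of 0] by (simp add: find_translation_def)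
  then have to1: "takes lam p xs (b, h, R) 1 (b + 1, 0, R)" by (simp add: takes_def)
  obtain h' where "takes lam p xs (b + 1, 0, R) (5 * length xs + 1)
    (if \<exists>c. (0, c) \<in> set xs \<and> sgn c = e then found else missing, h', R)"
    using find_translation_loop[OF code, of xs "[]" xs 0] e by auto
  from takes_trans[OF to1 this] show ?thesis by fastforce
qed

text \<open>Locations \<open>b + 1\<close> to \<open>b + 4\<close> search for a first fixed point, the remaining ones improve on
  it. Since registers cannot be copied, the improving branch jumps back to \<open>b + 5\<close>, which
  computes the fixed point again, now into \<open>r\<close>.\<close>

definition find_extremum ::
    "nat \<Rightarrow> int \<Rightarrow> rat \<Rightarrow> nat \<Rightarrow> nat \<Rightarrow> nat \<Rightarrow> nat \<Rightarrow> instr list" where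
  "find_extremum b s d r aux found missing =
     [Rewind,
      At_end missing (b + 2),
      on_sign s (b + 5) (b + 3),
      Advance,
      jump (b + 1),
      Fixed_point r,
      Advance,
      At_end found (b + 8),
      on_sign s (b + 9) (b + 6),
      Fixed_point aux,
      compare d aux r (b + 5) (b + 6) (b + 6)]"

lemma length_find_extremum [simp]: "length (find_extremum b s d r aux found missing) = 11"
  by (simp add: find_extremum_def)

text \<open>For \<open>d = 1\<close> this is the minimum of \<open>F\<close>, for
  \<open>d = -1\<close> its maximum.\<close>

definition least_at :: "rat \<Rightarrow> rat set \<Rightarrow> rat \<Rightarrow> bool" where
  "least_at d F x \<longleftrightarrow> x \<in> F \<and> (\<forall>y\<in>F. d * x \<le> d * y)"

lemma fixps_append:
  "fixps lam s (set (zs @ [g])) =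
    (if sgn (fst g) = s then insert (fixp lam g) (fixps lam s (set zs)) else fixps lam s (set zs))"
  by (auto simp: fixps_def)

text \<open>The invariant is that \<open>r\<close> holds the extremum over the entries already read.
  An improving entry costs the full six operations, as its fixed point is computed twice. The clause
  on the other registers lets the result of an earlier search survive.\<close>

lemma find_extremum_improve:
  assumes code: "code_at p b (find_extremum b s d r aux found missing)"
    and s: "s = 1 \<or> s = -1" and d: "d = 1 \<or> d = -1" and r: "r \<noteq> aux"
    and "xs = zs @ ys" "h = length zs" "least_at d (fixps lam s (set zs)) (R r)"
  shows "\<exists>h' R'. takes lam p xs (b + 7, h, R) (6 * length ys + 1) (found, h', R') \<and>
    least_at d (fixps lam s (set xs)) (R' r) \<and> (\<forall>i. i \<noteq> r \<longrightarrow> i \<noteq> aux \<longrightarrow> R' i = R i)"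
  using assms(5-)
proof (induction ys arbitrary: zs h R)
  case Nil
  have "step lam p xs (b + 7, h, R) = Continue (found, h, R)"
    using Nil step_code_at[OF code, of 7] by (simp add: find_extremum_def)
  then have "takes lam p xs (b + 7, h, R) 1 (found, h, R)" by (simp add: takes_def)
  then show ?case using Nil by auto
next
  case (Cons g ys)
  note instr = step_code_at[OF code, unfolded find_extremum_def, simplified]
  have h: "h < length xs" "xs ! h = g" using Cons.prems by simp_all
  have s5: "step lam p xs (b + 5, h, Q) = Continue (b + 6, h, Q(r := fixp lam g))"
    if "fst g \<noteq> 0" for Q
    using h that instr[of 5] by (simp add: fixp_def)
  have s6: "step lam p xs (b + 6, h, Q) = Continue (b + 7, Suc h, Q)" for Q
    using instr[of 6] by simp
  have s7: "step lam p xs (b + 7, h, R) = Continue (b + 8, h, R)"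
    using h instr[of 7] by simp
  have s8: "step lam p xs (b + 8, h, R) = Continue (if sgn (fst g) = s then b + 9 else b + 6, h, R)"
    using h instr[of 8] by (simp add: exec_on_sign[OF s])
  let ?R = "R(aux := fixp lam g)"
  have s9: "step lam p xs (b + 9, h, R) = Continue (b + 10, h, ?R)" if "fst g \<noteq> 0"
    using h that instr[of 9] by (simp add: fixp_def)
  \<comment> \<open>As \<open>r\<close> and \<open>aux\<close> differ, the candidate has not
    overwritten the current extremum.\<close>
  have s10: "step lam p xs (b + 10, h, ?R) =
      Continue (branch (d * (fixp lam g - R r)) (b + 5) (b + 6) (b + 6), h, ?R)"
    using r instr[of 10] by (simp add: exec_compare[OF d])
  have "\<exists>Q. takes lam p xs (b + 7, h, R) 6 (b + 7, Suc h, Q) \<and>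
    least_at d (fixps lam s (set (zs @ [g]))) (Q r) \<and> (\<forall>i. i \<noteq> r \<longrightarrow> i \<noteq> aux \<longrightarrow> Q i = R i)"
  proof (cases "sgn (fst g) = s")
    case False
    then have "takes lam p xs (b + 7, h, R) 3 (b + 7, Suc h, R)"
      using s6[of R] s7 s8 by (simp add: takes_def numeral_eq_Suc)
    then have "takes lam p xs (b + 7, h, R) 6 (b + 7, Suc h, R)" by (rule takes_weaken) simp
    then show ?thesis using False Cons.prems(3) unfolding fixps_append by auto
  next
    case True
    then have g: "fst g \<noteq> 0" using s by auto
    have to10: "takes lam p xs (b + 7, h, R) 3 (b + 10, h, ?R)"
      using True s7 s8 s9[OF g] by (simp add: takes_def numeral_eq_Suc)
    show ?thesis
    proof (cases "d * (fixp lam g - R r) < 0")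
      case less: True
      let ?R' = "?R(r := fixp lam g)"
      have "takes lam p xs (b + 10, h, ?R) 3 (b + 7, Suc h, ?R')"
        using less s5[OF g, of ?R] s6[of ?R'] s10
        by (simp add: takes_def branch_def numeral_eq_Suc del: fun_upd_apply)
      with to10 have "takes lam p xs (b + 7, h, R) 6 (b + 7, Suc h, ?R')"
        by (rule takes_trans) simp
      moreover have "least_at d (fixps lam s (set (zs @ [g]))) (?R' r)"
        using True less Cons.prems(3) unfolding fixps_append least_at_def
        by (force simp: algebra_simps)
      ultimately show ?thesis by (intro exI[of _ ?R']) simp
    next
      case False
      then have "takes lam p xs (b + 10, h, ?R) 2 (b + 7, Suc h, ?R)"
        using s6[of ?R] s10 by (simp add: takes_def branch_def numeral_eq_Suc)
      with to10 have "takes lam p xs (b + 7, h, R) 6 (b + 7, Suc h, ?R)"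
        by (rule takes_trans) simp
      moreover have "least_at d (fixps lam s (set (zs @ [g]))) (?R r)"
        using r True False Cons.prems(3) unfolding fixps_append least_at_def
        by (force simp: algebra_simps)
      ultimately show ?thesis by (intro exI[of _ ?R]) simp
    qed
  qed
  then obtain R1 where R1: "takes lam p xs (b + 7, h, R) 6 (b + 7, Suc h, R1)"
    "least_at d (fixps lam s (set (zs @ [g]))) (R1 r)" "\<forall>i. i \<noteq> r \<longrightarrow> i \<noteq> aux \<longrightarrow> R1 i = R i"
    by blast
  then obtain h' R' where "takes lam p xs (b + 7, Suc h, R1) (6 * length ys + 1) (found, h', R')"
    "least_at d (fixps lam s (set xs)) (R' r)" "\<forall>i. i \<noteq> r \<longrightarrow> i \<noteq> aux \<longrightarrow> R' i = R1 i"
    using Cons.IH[of "zs @ [g]" "Suc h" R1] Cons.prems by auto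
  moreover from this have "takes lam p xs (b + 7, h, R) (6 * length (g # ys) + 1) (found, h', R')"
    using takes_trans[OF R1(1)] by fastforce
  ultimately show ?case using R1(3) by metis
qed

text \<open>Before the first hit \<open>r\<close> holds no valid candidate, hence a separate phase
  whose invariant is an empty set of fixed points. The first hit makes \<open>r\<close> trivially
  extremal and passes control to the improving loop.\<close>

lemma find_extremum_loop:
  assumes code: "code_at p b (find_extremum b s d r aux found missing)"
    and s: "s = 1 \<or> s = -1" and d: "d = 1 \<or> d = -1" and r: "r \<noteq> aux"
    and "xs = zs @ ys" "h = length zs" "fixps lam s (set zs) = {}"
  shows "\<exists>h' R'. takes lam p xs (b + 1, h, R) (6 * length ys + 1)
      (if fixps lam s (set xs) = {} then missing else found, h', R') \<and>
    (fixps lam s (set xs) \<noteq> {} \<longrightarrow> least_at d (fixps lam s (set xs)) (R' r)) \<and>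
    (\<forall>i. i \<noteq> r \<longrightarrow> i \<noteq> aux \<longrightarrow> R' i = R i)"
  using assms(5-)
proof (induction ys arbitrary: zs h)
  case Nil
  have "step lam p xs (b + 1, h, R) = Continue (missing, h, R)"
    using Nil step_code_at[OF code, of 1] by (simp add: find_extremum_def)
  then have "takes lam p xs (b + 1, h, R) 1 (missing, h, R)" by (simp add: takes_def)
  then show ?case using Nil by auto
next
  case (Cons g ys)
  note instr = step_code_at[OF code, unfolded find_extremum_def, simplified]
  have h: "h < length xs" "xs ! h = g" using Cons.prems by simp_all
  have s1: "step lam p xs (b + 1, h, R) = Continue (b + 2, h, R)"
    using h instr[of 1] by simp
  have s2: "step lam p xs (b + 2, h, R) = Continue (if sgn (fst g) = s then b + 5 else b + 3, h, R)"
    using h instr[of 2] by (simp add: exec_on_sign[OF s])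
  show ?case
  proof (cases "sgn (fst g) = s")
    case True
    then have g: "fst g \<noteq> 0" using s by auto
    let ?R = "R(r := fixp lam g)"
    have s5: "step lam p xs (b + 5, h, R) = Continue (b + 6, h, ?R)"
      using g h instr[of 5] by (simp add: fixp_def)
    have s6: "step lam p xs (b + 6, h, ?R) = Continue (b + 7, Suc h, ?R)"
      using instr[of 6] by simp
    have to7: "takes lam p xs (b + 1, h, R) 4 (b + 7, Suc h, ?R)"
      using True s1 s2 s5 s6 by (simp add: takes_def numeral_eq_Suc)
    have "least_at d (fixps lam s (set (zs @ [g]))) (?R r)"
      using True Cons.prems(3) unfolding fixps_append least_at_def by simp
    then obtain h' R' where "takes lam p xs (b + 7, Suc h, ?R) (6 * length ys + 1) (found, h', R')"
      "least_at d (fixps lam s (set xs)) (R' r)" "\<forall>i. i \<noteq> r \<longrightarrow> i \<noteq> aux \<longrightarrow> R' i = R i"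
      using find_extremum_improve[OF code s d r, of xs "zs @ [g]" ys "Suc h" lam ?R] Cons.prems(1,2)
      by auto
    moreover from this have "fixps lam s (set xs) \<noteq> {}" by (auto simp: least_at_def)
    moreover have "takes lam p xs (b + 1, h, R) (6 * length (g # ys) + 1) (found, h', R')"
      using takes_trans[OF to7 calculation(1)] by fastforce
    ultimately show ?thesis by auto
  next
    case False
    have s3: "step lam p xs (b + 3, h, R) = Continue (b + 4, Suc h, R)"
      using instr[of 3] by simp
    have s4: "step lam p xs (b + 4, Suc h, R) = Continue (b + 1, Suc h, R)"
      using instr[of 4] by simp
    have to1: "takes lam p xs (b + 1, h, R) 4 (b + 1, Suc h, R)"
      using False s1 s2 s3 s4 by (simp add: takes_def numeral_eq_Suc)
    have "fixps lam s (set (zs @ [g])) = {}" using False Cons.prems(3) unfolding fixps_append by simp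
    then obtain h' R' where "takes lam p xs (b + 1, Suc h, R) (6 * length ys + 1)
        (if fixps lam s (set xs) = {} then missing else found, h', R')"
      "fixps lam s (set xs) \<noteq> {} \<longrightarrow> least_at d (fixps lam s (set xs)) (R' r)"
      "\<forall>i. i \<noteq> r \<longrightarrow> i \<noteq> aux \<longrightarrow> R' i = R i"
      using Cons.IH[of "zs @ [g]" "Suc h"] Cons.prems(1,2) by auto
    moreover from this have "takes lam p xs (b + 1, h, R) (6 * length (g # ys) + 1)
        (if fixps lam s (set xs) = {} then missing else found, h', R')"
      using takes_trans[OF to1] by fastforce
    ultimately show ?thesis by blast
  qed
qed

lemma find_extremum:
  assumes code: "code_at p b (find_extremum b s d r aux found missing)"
    and s: "s = 1 \<or> s = -1" and d: "d = 1 \<or> d = -1" and r: "r \<noteq> aux"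
  shows "\<exists>h' R'. takes lam p xs (b, h, R) (6 * length xs + 2)
      (if fixps lam s (set xs) = {} then missing else found, h', R') \<and>
    (fixps lam s (set xs) \<noteq> {} \<longrightarrow> least_at d (fixps lam s (set xs)) (R' r)) \<and>
    (\<forall>i. i \<noteq> r \<longrightarrow> i \<noteq> aux \<longrightarrow> R' i = R i)"
proof -
  have "step lam p xs (b, h, R) = Continue (b + 1, 0, R)"
    using step_code_at[OF code, of 0] by (simp add: find_extremum_def)
  then have to1: "takes lam p xs (b, h, R) 1 (b + 1, 0, R)" by (simp add: takes_def)
  have "fixps lam s (set []) = {}" by (simp add: fixps_def)
  then obtain h' R' where *: "takes lam p xs (b + 1, 0, R) (6 * length xs + 1)
      (if fixps lam s (set xs) = {} then missing else found, h', R')"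
    "fixps lam s (set xs) \<noteq> {} \<longrightarrow> least_at d (fixps lam s (set xs)) (R' r)"
    "\<forall>i. i \<noteq> r \<longrightarrow> i \<noteq> aux \<longrightarrow> R' i = R i"
    using find_extremum_loop[OF code s d r, of xs "[]" xs 0 lam R] by auto
  have "takes lam p xs (b, h, R) (6 * length xs + 2)
      (if fixps lam s (set xs) = {} then missing else found, h', R')"
    by (rule takes_trans[OF to1 *(1)]) simp
  then show ?thesis using *(2,3) by blast
qed

text \<open>With \<open>b - a\<close> extremal in direction \<open>d\<close>, the final comparison decides both whether there is a
  drift of sign \<open>d\<close> and, if not, whether \<open>0\<close> is a drift; zero translations are excluded
  beforehand.\<close>

definition find_drift :: "nat \<Rightarrow> rat \<Rightarrow> nat \<Rightarrow> nat \<Rightarrow> nat \<Rightarrow> instr list" where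
  "find_drift b d found yes no =
     find_translation b d found (b + 6) @
     find_extremum (b + 6) 1 d 0 2 (b + 17) no @
     find_extremum (b + 17) (-1) (-d) 1 2 (b + 28) no @
     [compare d 0 1 found yes no]"

lemma length_find_drift [simp]: "length (find_drift b d found yes no) = 29"
  by (simp add: find_drift_def)

text \<open>With n = \<open>length xs\<close>, one translation search, two extremum searches and one
  comparison cost (5n + 2) + 2(6n + 2) + 1 = 17n + 7.\<close>

lemma find_drift:
  assumes code: "code_at p b (find_drift b d found yes no)" and d: "d = 1 \<or> d = -1"
    and zero: "(0, 0) \<notin> set xs"
  shows "\<exists>h' R'. takes lam p xs (b, h, R) (17 * length xs + 7)
    (if \<exists>x\<in>drifts lam (set xs). d * x > 0 then found
     else if 0 \<in> drifts lam (set xs) then yes else no, h', R')"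
proof -
  define A B where "A = fixps lam 1 (set xs)" and "B = fixps lam (-1) (set xs)"
  have drift: "x \<in> drifts lam (set xs) \<longleftrightarrow> (0, x) \<in> set xs \<or> (\<exists>a\<in>A. \<exists>b\<in>B. x = b - a)" for x
    unfolding drifts_def A_def B_def by blast
  note c = code_at_append[OF code[unfolded find_drift_def]]
  note c' = code_at_append[OF c(2)]
  note c'' = code_at_append[OF c'(2)]
  have codes: "code_at p b (find_translation b d found (b + 6))"
    "code_at p (b + 6) (find_extremum (b + 6) 1 d 0 2 (b + 17) no)"
    "code_at p (b + 17) (find_extremum (b + 17) (-1) (-d) 1 2 (b + 28) no)"
    "code_at p (b + 28) [compare d 0 1 found yes no]"
    using c(1) c'(1) c'' by (simp_all add: add.commute)
  have d': "- d = 1 \<or> - d = - 1" using d by auto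
  obtain h1 where t1: "takes lam p xs (b, h, R) (5 * length xs + 2)
      (if \<exists>c. (0, c) \<in> set xs \<and> sgn c = d then found else b + 6, h1, R)"
    using find_translation[OF codes(1)] d by blast
  show ?thesis
  proof (cases "\<exists>c. (0, c) \<in> set xs \<and> sgn c = d")
    case True
    then have "\<exists>x\<in>drifts lam (set xs). d * x > 0"
      using d drift by (force simp: sgn_1_pos sgn_1_neg)
    moreover have "takes lam p xs (b, h, R) (17 * length xs + 7) (found, h1, R)"
      using takes_weaken[OF t1, of "17 * length xs + 7"] True by auto
    ultimately show ?thesis by auto
  next
    case False
    \<comment> \<open>Translations by \<open>0\<close> are excluded and none of sign
      \<open>d\<close> was found, so all of them point the other way and cannot affect the
      answer.\<close>
    have trans: "d * c < 0" if "(0, c) \<in> set xs" for c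
    proof -
      have "c \<noteq> 0" "sgn c \<noteq> d" using that zero False by auto
      then show ?thesis using d by (auto simp: sgn_if split: if_splits)
    qed
    obtain h2 R2 where t2: "takes lam p xs (b + 6, h1, R) (6 * length xs + 2)
        (if A = {} then no else b + 17, h2, R2)" "A \<noteq> {} \<Longrightarrow> least_at d A (R2 0)"
      using find_extremum[OF codes(2) _ d, of lam xs h1 R] unfolding A_def by auto
    have t12: "takes lam p xs (b, h, R) (11 * length xs + 4) (if A = {} then no else b + 17, h2, R2)"
      by (rule takes_trans[OF t1[unfolded if_not_P[OF False]] t2(1)]) simp
    show ?thesis
    proof (cases "A = {}")
      case True
      then have "\<not> (\<exists>x\<in>drifts lam (set xs). d * x > 0)" "0 \<notin> drifts lam (set xs)"
        using drift trans True by force+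
      moreover have "takes lam p xs (b, h, R) (17 * length xs + 7) (no, h2, R2)"
        using takes_weaken[OF t12, of "17 * length xs + 7"] True by simp
      ultimately show ?thesis by auto
    next
      case A: False
      have ne: "(1 :: nat) \<noteq> 2" by simp
      obtain h3 R3 where t3: "takes lam p xs (b + 17, h2, R2) (6 * length xs + 2)
          (if B = {} then no else b + 28, h3, R3)" "B \<noteq> {} \<Longrightarrow> least_at (- d) B (R3 1)"
        and R3: "\<forall>i. i \<noteq> 1 \<longrightarrow> i \<noteq> 2 \<longrightarrow> R3 i = R2 i"
        using find_extremum[OF codes(3) disjI2[OF refl] d' ne, of lam xs h2 R2, folded B_def] by blast
      \<comment> \<open>The second search changes at most registers 1 and 2, so the first extremum
        is still in register 0.\<close>
      have "R3 0 = R2 0" using R3 by simp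
      have t123: "takes lam p xs (b, h, R) (17 * length xs + 6) (if B = {} then no else b + 28, h3, R3)"
        by (rule takes_trans[OF t12[unfolded if_not_P[OF A]] t3(1)]) simp
      show ?thesis
      proof (cases "B = {}")
        case True
        then have "\<not> (\<exists>x\<in>drifts lam (set xs). d * x > 0)" "0 \<notin> drifts lam (set xs)"
          using drift trans True by force+
        moreover have "takes lam p xs (b, h, R) (17 * length xs + 7) (no, h3, R3)"
          using takes_weaken[OF t123, of "17 * length xs + 7"] True by simp
        ultimately show ?thesis by auto
      next
        case False
        let ?x = "R3 1 - R3 0"
        have ext: "R3 0 \<in> A" "R3 1 \<in> B" "\<And>a. a \<in> A \<Longrightarrow> d * R3 0 \<le> d * a"
          "\<And>b. b \<in> B \<Longrightarrow> d * b \<le> d * R3 1"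
          using t2(2) t3(2) A False \<open>R3 0 = R2 0\<close> by (auto simp: least_at_def)
        then have x: "?x \<in> drifts lam (set xs)" using drift by blast
        \<comment> \<open>Differences of fixed points are bounded by the extremal one, and
          translations have the opposite sign. Hence the sign of \<open>d * ?x\<close> alone
          decides.\<close>
        have max: "d * x \<le> d * ?x \<or> d * x < 0" if "x \<in> drifts lam (set xs)" for x
        proof -
          from that consider "(0, x) \<in> set xs" | a b where "a \<in> A" "b \<in> B" "x = b - a"
            using drift by blast
          then show ?thesis
          proof cases
            case 2
            then have "d * R3 0 \<le> d * a" "d * b \<le> d * R3 1" using ext by blast+
            then show ?thesis unfolding \<open>x = b - a\<close> right_diff_distrib by linarith
          qed (simp add: trans)
        qed
        \<comment> \<open>The program tests \<open>R3 0 - R3 1\<close>, the negative of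
          \<open>?x\<close>, so \<open>found\<close> is the target for a negative sign.\<close>
        have "(if \<exists>x\<in>drifts lam (set xs). d * x > 0 then found
          else if 0 \<in> drifts lam (set xs) then yes else no) = branch (d * (R3 0 - R3 1)) found yes no"
        proof (cases "d * ?x" "0 :: rat" rule: linorder_cases)
          case less
          then have "d * x < 0" if "x \<in> drifts lam (set xs)" for x using max[OF that] by linarith
          then show ?thesis using less by (force simp: branch_def algebra_simps)
        next
          case equal
          then have "d * x \<le> 0" if "x \<in> drifts lam (set xs)" for x using max[OF that] by linarith
          moreover have "?x = 0" using equal d by auto
          ultimately show ?thesis using x by (force simp: branch_def)
        next
          case greater
          then show ?thesis using x by (auto simp: branch_def algebra_simps)
        qed
        moreover have "step lam p xs (b + 28, h3, R3) =
          Continue (branch (d * (R3 0 - R3 1)) found yes no, h3, R3)"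
          using step_code_at[OF codes(4), of 0] by (simp add: exec_compare[OF d])
        ultimately have "takes lam p xs (b + 28, h3, R3) 1
          (if \<exists>x\<in>drifts lam (set xs). d * x > 0 then found
           else if 0 \<in> drifts lam (set xs) then yes else no, h3, R3)"
          by (simp add: takes_def)
        from takes_trans[OF t123[unfolded if_not_P[OF False]] this, of "17 * length xs + 7"]
        show ?thesis by (intro exI) simp
      qed
    qed
  qed
qed

section \<open>The complete program and its cost in terms of |S|\<close>

definition identity_program :: "instr list" where
  "identity_program =
     find_translation 0 0 64 6 @ find_drift 6 1 35 64 65 @ find_drift 35 (-1) 64 64 65 @
     [Answer True, Answer False]"

text \<open>Blocks of lengths 6, 29 and 29 start at 0, 6 and 35, leaving 64 and 65 for the two
  answers. The first block settles the case of a zero translation, as \<open>find_drift\<close>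
  requires. The search for a negative drift runs only once a positive one is known, so there both a
  negative and a zero drift accept. The cost is (5n + 2) + 2(17n + 7) + 1 = 39n + 17.\<close>

lemma identity_program:
  "answers_within lam identity_program xs (39 * length xs + 17)
    (0 \<in> drifts lam (set xs) \<or>
     (\<exists>x\<in>drifts lam (set xs). x > 0) \<and> (\<exists>x\<in>drifts lam (set xs). x < 0))"
    (is "answers_within _ ?p _ _ ?ans")
proof -
  have code: "code_at ?p 0 identity_program"
    unfolding code_at_def by simp
  have "code_at ?p 0 (find_translation 0 0 64 6 @ find_drift 6 1 35 64 65 @
      find_drift 35 (-1) 64 64 65 @ [Answer True, Answer False])"
    using code by (simp only: identity_program_def)
  note c = code_at_append[OF this]
  note c' = code_at_append[OF c(2)]
  note c'' = code_at_append[OF c'(2)]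
  have codes: "code_at ?p 0 (find_translation 0 0 64 6)"
    "code_at ?p 6 (find_drift 6 1 35 64 65)" "code_at ?p 35 (find_drift 35 (-1) 64 64 65)"
    "code_at ?p 64 [Answer True, Answer False]"
    using c(1) c'(1) c'' by simp_all
  have stop: "run lam ?p xs 1 (64, h, R) = Some True" "run lam ?p xs 1 (65, h, R) = Some False" for h R
    using step_code_at[OF codes(4), of 0] step_code_at[OF codes(4), of 1] by simp_all
  have main: "\<exists>h R. takes lam ?p xs (0, 0, \<lambda>_. 0) (39 * length xs + 16) (if ?ans then 64 else 65, h, R)"
  proof -
    obtain h1 where t1: "takes lam ?p xs (0, 0, \<lambda>_. 0) (5 * length xs + 2)
        (if (0, 0) \<in> set xs then 64 else 6, h1, \<lambda>_. 0)"
      using find_translation[OF codes(1), of lam xs 0 "\<lambda>_. 0"] by (auto simp: sgn_0_0)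
    show ?thesis
    proof (cases "(0, 0) \<in> set xs")
      case True
      then have ?ans by (simp add: drifts_def)
      moreover have "takes lam ?p xs (0, 0, \<lambda>_. 0) (39 * length xs + 16) (64, h1, \<lambda>_. 0)"
        using takes_weaken[OF t1, of "39 * length xs + 16"] True by simp
      ultimately show ?thesis by auto
    next
      case zero: False
      let ?P = "\<exists>x\<in>drifts lam (set xs). x > 0" and ?N = "\<exists>x\<in>drifts lam (set xs). x < 0"
        and ?Z = "0 \<in> drifts lam (set xs)"
      have t1: "takes lam ?p xs (0, 0, \<lambda>_. 0) (5 * length xs + 2) (6, h1, \<lambda>_. 0)"
        using t1 zero by simp
      obtain h2 R2 where "takes lam ?p xs (6, h1, \<lambda>_. 0) (17 * length xs + 7)
          (if ?P then 35 else if ?Z then 64 else 65, h2, R2)"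
        using find_drift[OF codes(2) _ zero, of lam h1 "\<lambda>_. 0"] by auto
      with t1 have t2: "takes lam ?p xs (0, 0, \<lambda>_. 0) (22 * length xs + 9)
          (if ?P then 35 else if ?Z then 64 else 65, h2, R2)"
        by (rule takes_trans) simp
      show ?thesis
      proof (cases ?P)
        case False
        \<comment> \<open>Without a positive drift, only the drift \<open>0\<close> can lead to
          acceptance.\<close>
        then have "(if ?P then 35 else if ?Z then 64 else 65 :: nat) = (if ?ans then 64 else 65)"
          by auto
        then have "takes lam ?p xs (0, 0, \<lambda>_. 0) (39 * length xs + 16)
            (if ?ans then 64 else 65, h2, R2)"
          using takes_weaken[OF t2, of "39 * length xs + 16"] by simp
        then show ?thesis by blast
      next
        case True
        obtain h3 R3 where t3: "takes lam ?p xs (35, h2, R2) (17 * length xs + 7)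
            (if ?N then 64 else if ?Z then 64 else 65, h3, R3)"
          using find_drift[OF codes(3) _ zero, of lam h2 R2] by auto
        have "(if ?N then 64 else if ?Z then 64 else 65 :: nat) = (if ?ans then 64 else 65)"
          using True by auto
        moreover have "takes lam ?p xs (0, 0, \<lambda>_. 0) (39 * length xs + 16)
            (if ?N then 64 else if ?Z then 64 else 65, h3, R3)"
          by (rule takes_trans[OF t2[unfolded if_P[OF True]] t3]) simp
        ultimately have "takes lam ?p xs (0, 0, \<lambda>_. 0) (39 * length xs + 16)
            (if ?ans then 64 else 65, h3, R3)" by simp
        then show ?thesis by blast
      qed
    qed
  qed
  then obtain h R where "takes lam ?p xs (0, 0, \<lambda>_. 0) (39 * length xs + 16)
      (if ?ans then 64 else 65, h, R)" by blast
  moreover have "run lam ?p xs 1 (if ?ans then 64 else 65, h, R) = Some ?ans"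
    using stop[of h R] by (cases ?ans) simp_all
  ultimately have "run lam ?p xs (1 + (39 * length xs + 16)) (0, 0, \<lambda>_. 0) = Some ?ans"
    unfolding takes_def by blast
  then show ?thesis
    unfolding answers_within_def by (simp only: add.commute[of 1] add.assoc) simp
qed

text \<open>The values at 0 and 1 determine \<open>c\<close> and the power of \<open>lam\<close>,
  and powers of \<open>lam > 1\<close> are strictly increasing in the exponent. Injectivity
  identifies the length of a distinct input list with \<open>card S\<close>.\<close>

lemma inj_affine:
  assumes "lam > 1"
  shows "inj (affine lam)"
proof (rule injI)
  fix g h assume eq: "affine lam g = affine lam h"
  then have "affine lam g x = affine lam h x" for x by simp
  from this[of 0] this[of 1] have "snd g = snd h" "lam powi fst g = lam powi fst h"
    by (simp_all add: affine_def case_prod_beta)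
  moreover have "fst g = fst h"
    using calculation(2) assms power_int_strict_increasing[of "fst g" "fst h" lam]
      power_int_strict_increasing[of "fst h" "fst g" lam] by (cases "fst g" "fst h" rule: linorder_cases) auto
  ultimately show "g = h" by (simp add: prod_eq_iff)
qed

theorem theorem31:
  fixes lam :: rat
  assumes "lam > 1"
  shows "\<exists>(p :: instr list) (T :: nat \<Rightarrow> nat).
           (\<lambda>n. real (T n)) \<in> O(\<lambda>n. real n) \<and>
           (\<forall>S xs. finite S \<and> S \<subseteq> carrier (affine_group lam) \<and>
                   distinct xs \<and> S = affine lam ` set xs \<longrightarrow>
              answers_within lam p xs (T (card S))
                (\<one>\<^bsub>affine_group lam\<^esub> \<in> semigroup_span (affine_group lam) S))"
proof (intro exI conjI allI impI)
  show "(\<lambda>n. real (39 * n + 17)) \<in> O(\<lambda>n. real n)"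
    \<comment> \<open>39n + 17 is at most 56n as soon as n is at least 1.\<close>
    by (rule bigoI[of _ 56]) (auto simp: eventually_at_top_linorder intro!: exI[of _ 1])
next
  fix S xs
  assume S: "finite S \<and> S \<subseteq> carrier (affine_group lam) \<and> distinct xs \<and> S = affine lam ` set xs"
  then have "card S = length xs"
    using inj_affine[OF assms] by (metis card_image distinct_card inj_on_subset subset_UNIV)
  then show "answers_within lam identity_program xs (39 * card S + 17)
      (\<one>\<^bsub>affine_group lam\<^esub> \<in> semigroup_span (affine_group lam) S)"
    using identity_program[of lam xs] id_in_span_iff[OF assms, of "set xs"] S
    by (simp add: affine_group_def)
qed

end
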